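(* Let $R=\bigoplus_{d\in\mathbb{N}}R_d$ be a Noetherian $\mathbb{N}$-graded domain and let $\mathcal{I}=\{I_{[k]}\}_{k\ge 0}$ be a Noetherian graded filtration of $R$ such that $I_{[k]}$ is a nonzero proper ideal for every $k\ge 1$. Then $\lim_{k\to\infty}\frac{\mathrm{v}(I_{[k]})}{k}$ exists and $$\lim_{k\to\infty}\frac{\mathrm{v}(I_{[k]})}{k}=\lim_{k\to\infty}\frac{\alpha(I_{[k]})}{k}.$$
   Context: $\mathbb{N}$ is the set of non-negative integers; rings are commutative with unity. A graded filtration of an $\mathbb{N}$-graded Noetherian domain $R$ is a family $\mathcal{I}=\{I_{[k]}\}_{k\ge 0}$ of graded (homogeneous) ideals of $R$ such that (i) $I_{[0]}=R$; (ii) $I_{[k+1]}\subseteq I_{[k]}$ for all $k\ge 0$; (iii) $I_{[k]}I_{[r]}\subseteq I_{[k+r]}$ for all $k,r\ge 0$. It is called Noetherian if the Rees algebra $R(\mathcal{I})=\bigoplus_{k\ge 0}I_{[k]}t^k$ is a Noetherian ring. For a nonzero graded ideal $I$, $\alpha(I)=\min\{d\mid I_d\neq 0\}$ is the minimum degree of a nonzero homogeneous element of $I$. For a proper graded ideal $I$, $\mathrm{Ass}(I)$ is the set of associated primes of $R/I$, and the v-number of $I$ is $$\mathrm{v}(I)=\min\{d\ge 0\mid \text{there exist } f\in R_d \text{ and } \mathfrak{p}\in\mathrm{Ass}(I)\text{ with } (I:f)=\mathfrak{p}\}.$$ *)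

theory Defs
  imports "HOL-Algebra.Algebra" Complex_Main
begin

text \<open>
  The decomposition of the ring as the direct sum of the \<open>G d\<close> is stated as existence and
  uniqueness of a finitely supported family of components. That \<open>\<one> \<in> G 0\<close> follows from the
  axioms.
\<close>

locale graded_ring = cring R for R (structure) +
  fixes G :: "nat \<Rightarrow> 'a set"
  assumes grade_subgroup: "additive_subgroup (G d) R"
    and grade_mult: "\<lbrakk>x \<in> G i; y \<in> G j\<rbrakk> \<Longrightarrow> x \<otimes> y \<in> G (i + j)"
    and grade_decomp: "x \<in> carrier R \<Longrightarrow>
      \<exists>!c. (\<forall>d. c d \<in> G d) \<and> finite {d. c d \<noteq> \<zero>} \<and> x = (\<Oplus>d \<in> {d. c d \<noteq> \<zero>}. c d)"

text \<open>A graded ideal is one with \<open>I = \<Oplus>\<^sub>d I\<^sub>d\<close>, where \<open>I\<^sub>d = I \<inter> G d\<close>.\<close>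

locale graded_ideal = graded_ring R G + ideal I R for I and R (structure) and G +
  assumes ideal_decomp: "x \<in> I \<Longrightarrow>
      \<exists>c. (\<forall>d. c d \<in> I \<inter> G d) \<and> finite {d. c d \<noteq> \<zero>} \<and> x = (\<Oplus>d \<in> {d. c d \<noteq> \<zero>}. c d)"

locale graded_filtration = graded_ring R G for R (structure) and G +
  fixes \<I> :: "nat \<Rightarrow> 'a set"
  assumes filtration_graded: "graded_ideal (\<I> k) R G"
    and filtration_0: "\<I> 0 = carrier R"
    and filtration_Suc: "\<I> (Suc k) \<subseteq> \<I> k"
    and filtration_mult: "\<I> k \<cdot> \<I> r \<subseteq> \<I> (k + r)"

text \<open>The Rees algebra, realised as a subring of the polynomial ring \<open>R[t]\<close>.\<close>

definition rees_algebra ::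
    "('a, 'm) ring_scheme \<Rightarrow> (nat \<Rightarrow> 'a set) \<Rightarrow> ('a, nat \<Rightarrow> 'a) up_ring" where
  "rees_algebra R \<I> = (UP R)\<lparr>carrier := {p \<in> carrier (UP R). \<forall>k. coeff (UP R) p k \<in> \<I> k}\<rparr>"

text \<open>For the zero ideal the value is unspecified.\<close>

definition initial_degree ::
    "('a, 'm) ring_scheme \<Rightarrow> (nat \<Rightarrow> 'a set) \<Rightarrow> 'a set \<Rightarrow> nat" where
  "initial_degree R G I = (LEAST d. I \<inter> G d \<noteq> {\<zero>\<^bsub>R\<^esub>})"

definition ideal_colon :: "('a, 'm) ring_scheme \<Rightarrow> 'a set \<Rightarrow> 'a \<Rightarrow> 'a set" where
  "ideal_colon R I f = {r \<in> carrier R. r \<otimes>\<^bsub>R\<^esub> f \<in> I}"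

text \<open>
  The prime ideals that are annihilators in \<open>R\<close> of an element \<open>u\<close> of the \<open>R\<close>-module \<open>R/I\<close>, on
  which \<open>r \<in> R\<close> acts as multiplication by its residue class.
\<close>

definition associated_primes :: "('a, 'm) ring_scheme \<Rightarrow> 'a set \<Rightarrow> 'a set set" where
  "associated_primes R I = {P. primeideal P R \<and> (\<exists>u \<in> carrier (R Quot I).
     P = {r \<in> carrier R. (I +>\<^bsub>R\<^esub> r) \<otimes>\<^bsub>R Quot I\<^esub> u = \<zero>\<^bsub>R Quot I\<^esub>})}"

text \<open>Unspecified if no such degree exists, in particular for \<open>I = R\<close>.\<close>

definition v_number ::
    "('a, 'm) ring_scheme \<Rightarrow> (nat \<Rightarrow> 'a set) \<Rightarrow> 'a set \<Rightarrow> nat" where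
  "v_number R G I =
     (LEAST d. \<exists>f \<in> G d. \<exists>P \<in> associated_primes R I. ideal_colon R I f = P)"

end

theory Submission
  imports Defs
begin

text \<open>
  Let the ideal of elements of positive \<open>t\<close>-degree of the Rees algebra be generated by finitely many
  \<open>g\<^sub>i t\<^bsup>m\<^sub>i\<^esup>\<close> with \<open>g\<^sub>i\<close> homogeneous of degree \<open>d\<^sub>i\<close>, and put \<open>\<rho> = min d\<^sub>i / m\<^sub>i\<close>. Every nonzero homogeneous
  element of \<open>\<I> k\<close> has degree at least \<open>\<rho> k\<close>. Moreover \<open>\<rho> = d / m\<close> for some \<open>f \<in> \<I> m\<close> of degree \<open>d\<close>
  such that \<open>f\<^sup>j \<notin> \<I> (j m + 1)\<close> for all \<open>j\<close>: if \<open>\<rho> > 0\<close> this holds for degree reasons; if \<open>\<rho> = 0\<close> and it failed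
  for all generators of degree 0, a nonzero element of degree 0 would lie in every \<open>\<I> k\<close>, which is
  impossible in a domain with Noetherian Rees algebra.

  The ideals \<open>(\<I> (j m + c) : f\<^sup>j)\<close> ascend in \<open>j\<close>, hence stabilise to a proper ideal; a homogeneous witness
  for its v-number, multiplied by \<open>f\<^sup>j\<close>, shows \<open>v (\<I> k) \<le> \<rho> k + O(1)\<close>. Conversely, a prime
  \<open>(\<I> k : g)\<close> contains \<open>\<I> 1\<close>, since \<open>\<I> 1\<^sup>k \<subseteq> \<I> k\<close>, so that \<open>\<alpha> (\<I> k) \<le> v (\<I> k) + \<alpha> (\<I> 1)\<close>.
\<close>

section \<open>Additive subgroups and ascending chains of ideals\<close>

lemma (in abelian_group) additive_subgroup_criterion:
  assumes "H \<subseteq> carrier G" and "\<zero> \<in> H"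
    and "\<And>x y. x \<in> H \<Longrightarrow> y \<in> H \<Longrightarrow> x \<oplus> y \<in> H"
    and "\<And>x. x \<in> H \<Longrightarrow> \<ominus> x \<in> H"
  shows "additive_subgroup H G"
  by (rule additive_subgroupI, rule add.subgroupI) (use assms in \<open>auto simp: a_inv_def\<close>)

lemma (in abelian_group) finsum_in_additive_subgroup:
  assumes H: "additive_subgroup H G" and f: "\<And>a. a \<in> A \<Longrightarrow> f a \<in> H"
  shows "finsum G f A \<in> H"
proof -
  interpret H: additive_subgroup H G by (rule H)
  show ?thesis
    using f
  proof (induction A rule: infinite_finite_induct)
    case (insert a A)
    then show ?case
      by (subst finsum_insert) (auto simp: Pi_def)
  qed auto
qed

lemma (in cring) ideal_criterion:
  assumes "additive_subgroup I R"
    and "\<And>a x. a \<in> I \<Longrightarrow> x \<in> carrier R \<Longrightarrow> x \<otimes> a \<in> I"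
  shows "ideal I R"
proof -
  interpret I: additive_subgroup I R by fact
  show ?thesis
    by (intro idealI ring_axioms I.a_subgroup) (use assms m_comm in auto)
qed

lemma (in ring) proper_ideal_iff_one:
  assumes "ideal I R"
  shows "I \<noteq> carrier R \<longleftrightarrow> \<one> \<notin> I"
  using ideal.one_imp_carrier[OF assms] by auto

section \<open>Colon ideals and associated primes\<close>

lemma (in cring) ideal_ideal_colon:
  assumes "ideal I R" and "f \<in> carrier R"
  shows "ideal (ideal_colon R I f) R"
proof -
  interpret I: ideal I R by fact
  show ?thesis
  proof (rule ideal_criterion)
    show "additive_subgroup (ideal_colon R I f) R"
      by (rule additive_subgroup_criterion)
        (use assms(2) in \<open>auto simp: ideal_colon_def l_distr l_minus\<close>)
  qed (use assms(2) in \<open>auto simp: ideal_colon_def m_assoc I.I_l_closed\<close>)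
qed

text \<open>Transfers a witness \<open>g\<close> for a colon ideal back to \<open>I\<close>, at the
  price of a factor \<open>f\<close>.\<close>

lemma (in cring) ideal_colon_mult:
  assumes "ideal I R" and "f \<in> carrier R" and "g \<in> carrier R"
  shows "ideal_colon R (ideal_colon R I f) g = ideal_colon R I (g \<otimes> f)"
  using assms by (auto simp: ideal_colon_def m_assoc)

text \<open>The annihilator of the residue class of \<open>f\<close> is \<open>(I : f)\<close>, so
  the condition in \<open>v_number\<close> amounts to primality of the colon ideal.\<close>

lemma (in cring) prime_colon_is_associated:
  assumes I: "ideal I R" and f: "f \<in> carrier R" and P: "primeideal (ideal_colon R I f) R"
  shows "ideal_colon R I f \<in> associated_primes R I"
proof -
  interpret I: ideal I R by (rule I)
  have "(I +> r) \<otimes>\<^bsub>R Quot I\<^esub> (I +> f) = \<zero>\<^bsub>R Quot I\<^esub> \<longleftrightarrow> r \<otimes> f \<in> I"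
    if "r \<in> carrier R" for r
  proof -
    have "I +> r \<otimes> f = I \<longleftrightarrow> r \<otimes> f \<in> I"
      using a_rcos_zero[OF I] I.rcos_const_imp_mem m_closed[OF that f] by auto
    then show ?thesis using that f by (simp add: FactRing_def I.rcoset_mult_add)
  qed
  then have "ideal_colon R I f =
      {r \<in> carrier R. (I +> r) \<otimes>\<^bsub>R Quot I\<^esub> (I +> f) = \<zero>\<^bsub>R Quot I\<^esub>}"
    by (auto simp: ideal_colon_def)
  moreover have "I +> f \<in> carrier (R Quot I)"
    using f by (auto simp: FactRing_simps)
  ultimately show ?thesis
    using P unfolding associated_primes_def by blast
qed

section \<open>Chain conditions\<close>

lemma (in noetherian_ring) ascending_ideals_stabilise:
  fixes J :: "nat \<Rightarrow> 'a set"
  assumes J: "\<And>n. ideal (J n) R" and mono: "\<And>n. J n \<subseteq> J (Suc n)"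
  shows "\<exists>n. \<forall>i\<ge>n. J i = J n"
proof -
  have le: "J i \<subseteq> J j" if "i \<le> j" for i j
    using lift_Suc_mono_le[of J, OF mono that] .
  have "\<Union>(range J) \<in> range J"
  proof (rule ideal_chain_is_trivial)
    have "J i \<subseteq> J j \<or> J j \<subseteq> J i" for i j
      using le nat_le_linear[of i j] by blast
    then show "subset.chain {I. ideal I R} (range J)"
      unfolding subset_chain_def using J by auto
  qed auto
  then obtain n where "\<Union>(range J) = J n" by blast
  then show ?thesis using le by (intro exI[of _ n]) blast
qed

text \<open>Without a maximal member, a choice \<open>s\<close> of strictly larger members would
  iterate to a strictly ascending chain.\<close>

lemma (in noetherian_ring) exists_maximal_ideal_in_family:
  assumes "F \<noteq> {}" and "\<And>I. I \<in> F \<Longrightarrow> ideal I R"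
  shows "\<exists>M\<in>F. \<forall>I\<in>F. M \<subseteq> I \<longrightarrow> I = M"
proof (rule ccontr)
  assume "\<not> ?thesis"
  then obtain s where s: "\<And>M. M \<in> F \<Longrightarrow> s M \<in> F \<and> M \<subset> s M"
    by (metis psubsetI)
  obtain M0 where M0: "M0 \<in> F" using assms by blast
  define J where "J n = (s ^^ n) M0" for n
  have JF: "J n \<in> F" for n
    by (induction n) (use M0 s in \<open>auto simp: J_def\<close>)
  have "J n \<subset> J (Suc n)" for n
    using s[OF JF[of n]] by (simp add: J_def)
  moreover from this JF obtain n where "\<forall>i\<ge>n. J i = J n"
    using ascending_ideals_stabilise[of J] assms(2) by blast
  ultimately show False
    by (metis le_SucI order_refl psubsetE)
qed

text \<open>The sum of the coefficients is the value at \<open>t = 1\<close>, and evaluation is a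
  ring homomorphism.\<close>

lemma (in UP_cring) sum_coeff_mult:
  assumes p: "p \<in> carrier P" and q: "q \<in> carrier P"
  shows "(\<Oplus>i \<in> {..deg R (p \<otimes>\<^bsub>P\<^esub> q)}. up_ring.coeff P (p \<otimes>\<^bsub>P\<^esub> q) i) =
    (\<Oplus>i \<in> {..deg R p}. up_ring.coeff P p i) \<otimes> (\<Oplus>i \<in> {..deg R q}. up_ring.coeff P q i)"
proof -
  interpret UP_pre_univ_prop R R id by unfold_locales simp
  have "UnivPoly.eval R R id \<one> r = (\<Oplus>i \<in> {..deg R r}. up_ring.coeff P r i)"
    if "r \<in> carrier P" for r
    using that by (simp add: eval_on_carrier)
  then show ?thesis
    using ring_hom_mult[OF eval_ring_hom p q, of \<one>] p q by simp
qed

section \<open>Homogeneous components\<close>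

definition (in graded_ring) component :: "'a \<Rightarrow> nat \<Rightarrow> 'a" where
  "component x = (THE c. (\<forall>d. c d \<in> G d) \<and> finite {d. c d \<noteq> \<zero>} \<and> x = (\<Oplus>d \<in> {d. c d \<noteq> \<zero>}. c d))"

context graded_ring
begin

lemma grade_carrier: "x \<in> G d \<Longrightarrow> x \<in> carrier R"
  using additive_subgroup.a_subset[OF grade_subgroup] by blast

lemma grade_zero: "\<zero> \<in> G d"
  using additive_subgroup.zero_closed[OF grade_subgroup] .

lemma component_properties:
  assumes "x \<in> carrier R"
  shows component_grade: "component x d \<in> G d"
    and finite_components: "finite {d. component x d \<noteq> \<zero>}"
    and sum_components: "x = (\<Oplus>d \<in> {d. component x d \<noteq> \<zero>}. component x d)"
  using theI'[OF grade_decomp[OF assms], folded component_def] by blast+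

lemma component_closed: "x \<in> carrier R \<Longrightarrow> component x d \<in> carrier R"
  using component_grade grade_carrier by blast

lemma sum_components_superset:
  assumes "x \<in> carrier R" and "finite D" and "{d. component x d \<noteq> \<zero>} \<subseteq> D"
  shows "x = (\<Oplus>d \<in> D. component x d)"
proof -
  have "(\<Oplus>d \<in> {d. component x d \<noteq> \<zero>}. component x d) = (\<Oplus>d \<in> D. component x d)"
    by (rule add.finprod_mono_neutral_cong_left) (use assms component_closed in auto)
  then show ?thesis using sum_components[OF assms(1)] by simp
qed

lemma component_eqI:
  assumes c: "\<And>d. c d \<in> G d" and D: "finite D" "\<And>d. d \<notin> D \<Longrightarrow> c d = \<zero>"
    and x: "x = (\<Oplus>d \<in> D. c d)"
  shows "component x = c"
proof -
  have cc: "c d \<in> carrier R" for d using c grade_carrier by blast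
  have x': "x = (\<Oplus>d \<in> {d. c d \<noteq> \<zero>}. c d)"
    unfolding x by (rule add.finprod_mono_neutral_cong_right) (use D cc in auto)
  have "finite {d. c d \<noteq> \<zero>}"
    by (rule finite_subset[OF _ D(1)]) (use D(2) in auto)
  moreover have "x \<in> carrier R" unfolding x using cc by auto
  ultimately show ?thesis
    unfolding component_def
    by (intro the1_equality[OF grade_decomp]) (use c x' in auto)
qed

lemma component_homogeneous:
  assumes "x \<in> G e"
  shows "component x d = (if d = e then x else \<zero>)"
proof -
  have "component x = (\<lambda>d. if d = e then x else \<zero>)"
    by (rule component_eqI[where D = "{e}"]) (use assms grade_zero grade_carrier in auto)
  then show ?thesis by simp
qed

lemma component_zero: "component \<zero> d = \<zero>"
  using component_homogeneous[OF grade_zero, of d d] by simp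

lemma component_add:
  assumes "x \<in> carrier R" and "y \<in> carrier R"
  shows "component (x \<oplus> y) d = component x d \<oplus> component y d"
proof -
  let ?D = "{d. component x d \<noteq> \<zero>} \<union> {d. component y d \<noteq> \<zero>}"
  have "component (x \<oplus> y) = (\<lambda>d. component x d \<oplus> component y d)"
  proof (rule component_eqI[where D = ?D])
    show "finite ?D" using finite_components assms by blast
    then have "x = (\<Oplus>d \<in> ?D. component x d)" "y = (\<Oplus>d \<in> ?D. component y d)"
      using assms by (auto intro: sum_components_superset)
    then show "x \<oplus> y = (\<Oplus>d \<in> ?D. component x d \<oplus> component y d)"
      using finsum_addf[of "component x" ?D "component y"] component_closed assms by auto
  qed (use assms component_grade additive_subgroup.a_closed[OF grade_subgroup] in auto)
  then show ?thesis by simp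
qed

lemma component_minus:
  assumes "x \<in> carrier R"
  shows "component (\<ominus> x) d = \<ominus> component x d"
proof -
  have "component (\<ominus> x) d \<oplus> component x d = \<zero>"
    using component_add[of "\<ominus> x" x d] assms by (simp add: l_neg component_zero)
  then show ?thesis
    using assms component_closed minus_equality by (metis a_inv_closed)
qed

text \<open>The map sending \<open>x\<close> to the polynomial \<open>\<Sum>\<^sub>d x\<^sub>d t\<^sup>d\<close> is a section of evaluation at
  \<open>t = 1\<close>, so the Cauchy product of components is read off a product of polynomials.\<close>

lemma component_polynomial:
  assumes z: "z \<in> carrier R"
  shows "component z \<in> carrier (UP R)"
    and "up_ring.coeff (UP R) (component z) = component z"
    and "(\<Oplus>i \<in> {..deg R (component z)}. component z i) = z"
proof -
  obtain N where "\<forall>d\<in>{d. component z d \<noteq> \<zero>}. d \<le> N"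
    using finite_components[OF z] finite_nat_set_iff_bounded_le by blast
  then have "bound \<zero> N (component z)"
    by (intro bound.intro) (use not_le in blast)
  then have up: "component z \<in> up R"
    using component_closed[OF z] by blast
  then show *: "component z \<in> carrier (UP R)" "up_ring.coeff (UP R) (component z) = component z"
    by (simp_all add: UP_def)
  interpret UP_cring R "UP R" by unfold_locales
  show "(\<Oplus>i \<in> {..deg R (component z)}. component z i) = z"
  proof (rule sum_components_superset[OF z, symmetric])
    show "{d. component z d \<noteq> \<zero>} \<subseteq> {..deg R (component z)}"
      using deg_aboveD[of "component z"] * by (auto simp: not_le[symmetric])
  qed simp
qed

lemma component_mult:
  assumes x: "x \<in> carrier R" and y: "y \<in> carrier R"
  shows "component (x \<otimes> y) n = (\<Oplus>i \<in> {..n}. component x i \<otimes> component y (n - i))"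
proof -
  note in_grade = finsum_in_additive_subgroup[OF grade_subgroup]
  interpret UP_cring R "UP R" by unfold_locales
  let ?p = "component x \<otimes>\<^bsub>UP R\<^esub> component y"
  have p: "?p \<in> carrier (UP R)" using component_polynomial x y by simp
  have coeff_p: "up_ring.coeff (UP R) ?p k = (\<Oplus>i \<in> {..k}. component x i \<otimes> component y (k - i))" for k
    using component_polynomial x y by simp
  have grade: "up_ring.coeff (UP R) ?p k \<in> G k" for k
    unfolding coeff_p
  proof (rule in_grade)
    fix i assume "i \<in> {..k}"
    then show "component x i \<otimes> component y (k - i) \<in> G k"
      using grade_mult[of "component x i" i "component y (k - i)" "k - i"] component_grade x y by simp
  qed
  \<comment> \<open>The coefficients of \<open>?p\<close> are homogeneous of the right degrees and
    add up to \<open>x \<otimes> y\<close>, so uniqueness of components applies.\<close>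
  have "component (x \<otimes> y) = up_ring.coeff (UP R) ?p"
  proof (rule component_eqI[where D = "{..deg R ?p}"])
    show "x \<otimes> y = (\<Oplus>i \<in> {..deg R ?p}. up_ring.coeff (UP R) ?p i)"
      using sum_coeff_mult[of "component x" "component y"] component_polynomial x y by simp
  qed (use p grade deg_aboveD in auto)
  then show ?thesis using coeff_p by simp
qed

lemma component_mult_homogeneous:
  assumes x: "x \<in> carrier R" and g: "g \<in> G e"
  shows "component (x \<otimes> g) n = (if e \<le> n then component x (n - e) \<otimes> g else \<zero>)"
proof -
  have "component (x \<otimes> g) n = (\<Oplus>i \<in> {..n}. component x i \<otimes> component g (n - i))"
    using component_mult x g grade_carrier by blast
  \<comment> \<open>The guard \<open>e \<le> n\<close> matters: truncated subtraction gives
    \<open>n - e = 0\<close> when \<open>e > n\<close>.\<close>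
  also have "\<dots> = (\<Oplus>i \<in> {..n}. if n - e = i \<and> e \<le> n then component x i \<otimes> g else \<zero>)"
    by (rule finsum_cong')
      (use x g grade_carrier component_closed in \<open>auto simp: component_homogeneous[OF g]\<close>)
  also have "\<dots> = (if e \<le> n then component x (n - e) \<otimes> g else \<zero>)"
    using finsum_singleton[of "n - e" "{..n}" "\<lambda>i. component x i \<otimes> g"]
      x g grade_carrier component_closed
    by (cases "e \<le> n") (auto simp: Pi_def)
  finally show ?thesis .
qed

text \<open>Comparing degree \<open>d\<close> components in \<open>\<one> \<otimes> x = x\<close>
  shows that the degree 0 component of \<open>\<one>\<close> fixes every homogeneous element. It
  therefore fixes every component of \<open>\<one>\<close>, hence \<open>\<one>\<close>
  itself.\<close>

lemma one_grade_0: "\<one> \<in> G 0"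
proof -
  let ?u = "component \<one> 0"
  have "x = ?u \<otimes> x" if x: "x \<in> G d" for x d
  proof -
    have "component x d = component (\<one> \<otimes> x) d" using x grade_carrier by simp
    then show ?thesis
      using component_mult_homogeneous[OF one_closed x, of d] component_homogeneous[OF x, of d] by simp
  qed
  note unit = this
  have "\<one> = (\<Oplus>d \<in> {d. component \<one> d \<noteq> \<zero>}. component \<one> d)"
    by (rule sum_components) simp
  also have "\<dots> = (\<Oplus>d \<in> {d. component \<one> d \<noteq> \<zero>}. ?u \<otimes> component \<one> d)"
  proof (rule finsum_cong')
    fix d
    show "component \<one> d = ?u \<otimes> component \<one> d"
      by (rule unit[OF component_grade]) simp
  qed (use component_closed in auto)
  also have "\<dots> = ?u \<otimes> (\<Oplus>d \<in> {d. component \<one> d \<noteq> \<zero>}. component \<one> d)"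
    by (rule finsum_rdistr[symmetric]) (use finite_components component_closed in auto)
  also have "\<dots> = ?u"
    using sum_components[OF one_closed] component_closed[OF one_closed] by simp
  finally show ?thesis using component_grade[of \<one> 0] by simp
qed

lemma grade_pow: "x \<in> G d \<Longrightarrow> x [^] (n::nat) \<in> G (n * d)"
  by (induction n) (auto simp: one_grade_0 add.commute dest: grade_mult)

lemma graded_idealI:
  assumes "ideal I R" and "\<And>x d. x \<in> I \<Longrightarrow> component x d \<in> I"
  shows "graded_ideal I R G"
proof -
  interpret ideal I R by fact
  show ?thesis
  proof
    fix x assume "x \<in> I"
    then show "\<exists>c. (\<forall>d. c d \<in> I \<inter> G d) \<and> finite {d. c d \<noteq> \<zero>} \<and> x = (\<Oplus>d \<in> {d. c d \<noteq> \<zero>}. c d)"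
      using assms(2) component_grade finite_components sum_components
      by (intro exI[of _ "component x"]) (metis IntI Icarr)
  qed
qed

lemma in_ideal_if_components:
  assumes "ideal I R" and "x \<in> carrier R" and "\<And>d. component x d \<in> I"
  shows "x \<in> I"
  by (subst sum_components[OF assms(2)])
    (rule finsum_in_additive_subgroup, use assms in \<open>auto simp: ideal.axioms(1)\<close>)

end

section \<open>Graded ideals and homogeneous prime colons\<close>

lemma (in graded_ideal) component_in:
  assumes "x \<in> I"
  shows "component x d \<in> I"
proof -
  obtain c where c: "\<forall>d. c d \<in> I \<inter> G d" "finite {d. c d \<noteq> \<zero>}" "x = (\<Oplus>d \<in> {d. c d \<noteq> \<zero>}. c d)"
    using ideal_decomp[OF assms] by blast
  then have "component x = c"
    by (intro component_eqI[where D = "{d. c d \<noteq> \<zero>}"]) auto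
  then show ?thesis using c by auto
qed

text \<open>Ensures that the \<open>LEAST\<close> in \<open>initial_degree\<close> is
  attained.\<close>

lemma (in graded_ideal) exists_nonzero_homogeneous:
  assumes "I \<noteq> {\<zero>}"
  shows "\<exists>d. I \<inter> G d \<noteq> {\<zero>}"
proof (rule ccontr)
  assume "\<not> ?thesis"
  then have "component x d = \<zero>" if "x \<in> I" for x d
    using that component_in component_grade by (metis Icarr IntI singletonD)
  then have "x = \<zero>" if "x \<in> I" for x
    using in_ideal_if_components[OF zeroideal, of x] that Icarr by simp
  then show False using assms zero_closed by blast
qed

lemma (in graded_ideal) graded_ideal_colon:
  assumes f: "f \<in> G e"
  shows "graded_ideal (ideal_colon R I f) R G"
proof (rule graded_idealI)
  show "ideal (ideal_colon R I f) R"
    using ideal_ideal_colon[OF is_ideal] f grade_carrier by blast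
next
  fix x d assume "x \<in> ideal_colon R I f"
  then have x: "x \<in> carrier R" "x \<otimes> f \<in> I" by (auto simp: ideal_colon_def)
  \<comment> \<open>Multiplication by \<open>f\<close> shifts degrees by \<open>e\<close>, so this
    component is \<open>component x d \<otimes> f\<close>.\<close>
  then have "component (x \<otimes> f) (d + e) \<in> I" using component_in by blast
  then show "component x d \<in> ideal_colon R I f"
    using x component_closed by (simp add: ideal_colon_def component_mult_homogeneous[OF _ f])
qed

text \<open>The component of \<open>x y\<close> in the sum of the lowest degrees in which \<open>x\<close>, respectively \<open>y\<close>,
  has a component outside \<open>I\<close> is congruent modulo \<open>I\<close> to the product of these two components.\<close>

lemma (in graded_ideal) primeideal_if_homogeneous_prime:
  assumes "I \<noteq> carrier R"
    and prime: "\<And>i j x y. \<lbrakk>x \<in> G i; y \<in> G j; x \<otimes> y \<in> I\<rbrakk> \<Longrightarrow> x \<in> I \<or> y \<in> I"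
  shows "primeideal I R"
proof (rule primeidealI)
  fix x y assume x: "x \<in> carrier R" and y: "y \<in> carrier R" and xy: "x \<otimes> y \<in> I"
  show "x \<in> I \<or> y \<in> I"
  proof (rule ccontr)
    assume "\<not> ?thesis"
    then have ex: "\<exists>d. component x d \<notin> I" "\<exists>d. component y d \<notin> I"
      using in_ideal_if_components[OF is_ideal] x y by blast+
    define i where "i = (LEAST d. component x d \<notin> I)"
    define j where "j = (LEAST d. component y d \<notin> I)"
    have i: "component x i \<notin> I" "\<And>l. l < i \<Longrightarrow> component x l \<in> I"
      unfolding i_def using LeastI_ex[OF ex(1)] not_less_Least by blast+
    have j: "component y j \<notin> I" "\<And>l. l < j \<Longrightarrow> component y l \<in> I"
      unfolding j_def using LeastI_ex[OF ex(2)] not_less_Least by blast+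
    let ?t = "\<lambda>l. component x l \<otimes> component y (i + j - l)"
    have t: "?t l \<in> carrier R" for l using component_closed x y by auto
    have "(\<Oplus>l \<in> {..i + j} - {i}. ?t l) \<in> I"
    proof (rule finsum_in_additive_subgroup[OF is_additive_subgroup])
      fix l assume l: "l \<in> {..i + j} - {i}"
      then consider "l < i" | "i + j - l < j" by fastforce
      then show "?t l \<in> I"
        using i(2) j(2) I_l_closed I_r_closed component_closed x y by cases auto
    qed
    moreover have "component (x \<otimes> y) (i + j) \<in> I"
      using component_in xy by blast
    moreover have "component (x \<otimes> y) (i + j) = ?t i \<oplus> (\<Oplus>l \<in> {..i + j} - {i}. ?t l)"
    proof -
      have "{..i + j} = insert i ({..i + j} - {i})" by auto
      then show ?thesis
        unfolding component_mult[OF x y] by (subst (1) \<open>{..i + j} = _\<close>, subst finsum_insert)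
          (use t t[of i] in auto)
    qed
    ultimately have "?t i \<in> I"
      using t by (metis (no_types, lifting) Icarr a_closed a_inv_closed add.inv_solve_right')
    then show False
      using prime[of "component x i" i "component y j" j] i j component_grade x y by simp
  qed
qed (use assms(1) is_ideal is_cring in auto)

text \<open>A maximal member among the proper colon ideals by homogeneous elements is prime; being
  graded, it need only be tested on homogeneous elements.\<close>

lemma (in graded_ideal) exists_homogeneous_prime_colon:
  assumes "noetherian_ring R" and "I \<noteq> carrier R"
  shows "\<exists>e. \<exists>g\<in>G e. primeideal (ideal_colon R I g) R"
proof -
  let ?F = "{ideal_colon R I g |g e. g \<in> G e \<and> g \<notin> I}"
  have "\<one> \<notin> I" using proper_ideal_iff_one[OF is_ideal] assms(2) by simp
  then have "?F \<noteq> {}" using one_grade_0 by blast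
  moreover have "ideal L R" if "L \<in> ?F" for L
    using that ideal_ideal_colon[OF is_ideal] grade_carrier by blast
  ultimately have "\<exists>M\<in>?F. \<forall>L\<in>?F. M \<subseteq> L \<longrightarrow> L = M"
    by (rule noetherian_ring.exists_maximal_ideal_in_family[OF assms(1)])
  then obtain M where "M \<in> ?F" and M: "\<forall>L\<in>?F. M \<subseteq> L \<longrightarrow> L = M" ..
  then obtain g e where g: "g \<in> G e" "g \<notin> I" and Mg: "M = ideal_colon R I g" by blast
  have graded: "graded_ideal M R G"
    unfolding Mg by (rule graded_ideal_colon[OF g(1)])
  then have ideal: "ideal M R" by (rule graded_ideal.axioms)
  have gc: "g \<in> carrier R" using g grade_carrier by blast
  have "primeideal M R"
  proof (rule graded_ideal.primeideal_if_homogeneous_prime[OF graded])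
    show "M \<noteq> carrier R"
      using proper_ideal_iff_one[OF ideal] g gc by (simp add: Mg ideal_colon_def)
  next
    fix i j x y assume x: "x \<in> G i" and y: "y \<in> G j" and xy: "x \<otimes> y \<in> M"
    have c: "x \<in> carrier R" "y \<in> carrier R" using x y grade_carrier by auto
    show "x \<in> M \<or> y \<in> M"
    proof (cases "y \<in> M")
      case False
      then have "y \<otimes> g \<notin> I" using c by (simp add: Mg ideal_colon_def)
      then have "ideal_colon R I (y \<otimes> g) \<in> ?F"
        using grade_mult[OF y g(1)] by blast
      \<comment> \<open>Since \<open>y \<otimes> g\<close> lies outside \<open>I\<close>, maximality
        turns this inclusion into an equality.\<close>
      moreover have "M \<subseteq> ideal_colon R I (y \<otimes> g)"
        using c gc I_l_closed by (auto simp: Mg ideal_colon_def m_lcomm[of _ y g])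
      ultimately have "ideal_colon R I (y \<otimes> g) = M" using M by blast
      moreover have "x \<in> ideal_colon R I (y \<otimes> g)"
        using xy c gc by (simp add: Mg ideal_colon_def m_assoc)
      ultimately show ?thesis by blast
    qed simp
  qed
  then show ?thesis using g Mg by blast
qed

lemma (in domain) nat_pow_nonzero:
  assumes "x \<in> carrier R" and "x \<noteq> \<zero>"
  shows "x [^] (n::nat) \<noteq> \<zero>"
  by (induction n) (use assms in \<open>auto simp: integral_iff\<close>)

lemma (in primeideal) nat_pow_in_prime:
  assumes "x \<in> carrier R" and "x [^] (n::nat) \<in> I"
  shows "x \<in> I"
  using assms(2)
proof (induction n)
  case 0
  then show ?case using one_imp_carrier I_notcarr by simp
next
  case (Suc n)
  then show ?case using I_prime[of "x [^] n" x] assms(1) by auto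
qed

section \<open>Noetherian graded filtrations\<close>

lemma rees_algebra_simps:
  "carrier (rees_algebra R \<I>) = {p \<in> carrier (UP R). \<forall>k. up_ring.coeff (UP R) p k \<in> \<I> k}"
  "monoid.mult (rees_algebra R \<I>) = monoid.mult (UP R)"
  "ring.add (rees_algebra R \<I>) = ring.add (UP R)"
  "ring.zero (rees_algebra R \<I>) = ring.zero (UP R)"
  by (simp_all add: rees_algebra_def)

locale noetherian_graded_filtration = graded_filtration R G \<I> + noetherian_domain R
  for R (structure) and G and \<I> +
  assumes rees_noetherian: "noetherian_ring (rees_algebra R \<I>)"
    and nonzero: "k \<ge> 1 \<Longrightarrow> \<I> k \<noteq> {\<zero>}"
    and proper: "k \<ge> 1 \<Longrightarrow> \<I> k \<noteq> carrier R"
begin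

lemma filtration_ideal: "ideal (\<I> k) R"
  using filtration_graded by (rule graded_ideal.axioms)

lemma filtration_subgroup: "additive_subgroup (\<I> k) R"
  using filtration_ideal by (rule ideal.axioms)

lemma filtration_carrier: "x \<in> \<I> k \<Longrightarrow> x \<in> carrier R"
  using ideal.Icarr[OF filtration_ideal] .

lemma filtration_antimono: "i \<le> j \<Longrightarrow> \<I> j \<subseteq> \<I> i"
  by (rule lift_Suc_antimono_le[of \<I>, OF filtration_Suc])

lemma filtration_antimonoD: "x \<in> \<I> j \<Longrightarrow> i \<le> j \<Longrightarrow> x \<in> \<I> i"
  using filtration_antimono by blast

lemma filtration_m_closed: "x \<in> \<I> i \<Longrightarrow> y \<in> \<I> j \<Longrightarrow> x \<otimes> y \<in> \<I> (i + j)"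
  by (rule subsetD[OF filtration_mult ideal_prod.prod])

lemma filtration_component: "x \<in> \<I> k \<Longrightarrow> component x d \<in> \<I> k"
  using graded_ideal.component_in[OF filtration_graded] .

lemma filtration_nat_pow: "x \<in> \<I> m \<Longrightarrow> x [^] (n::nat) \<in> \<I> (n * m)"
proof (induction n)
  case (Suc n)
  then show ?case using filtration_m_closed[of "x [^] n" "n * m" x m] by (simp add: add.commute)
qed (simp add: filtration_0)

lemma filtration_finprod:
  assumes "finite A" and "\<And>t. t \<in> A \<Longrightarrow> x t \<in> \<I> (n t)"
  shows "finprod R x A \<in> \<I> (sum n A)"
  using assms
proof (induction A)
  case empty
  then show ?case by (simp add: filtration_0)
next
  case (insert t A)
  then have "x \<in> A \<rightarrow> carrier R" "x t \<in> carrier R" using filtration_carrier by auto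
  then show ?case using insert filtration_m_closed by simp
qed

section \<open>Ideals of the Rees algebra\<close>

lemma UP_ring: "UP_ring R"
  by unfold_locales

lemma UP_monom:
  assumes "a \<in> carrier R"
  shows "up_ring.monom (UP R) a n \<in> carrier (UP R)"
    and "up_ring.coeff (UP R) (up_ring.monom (UP R) a n) k = (if n = k then a else \<zero>)"
  using UP_ring.monom_closed[OF UP_ring] UP_ring.coeff_monom[OF UP_ring] assms by auto

text \<open>The Cauchy product formula reduces closure under multiplication to single coefficients.
  Supplies the ideals, homogeneous in \<open>t\<close>, that are used below.\<close>

lemma ideal_rees_algebra:
  assumes W: "\<And>k. additive_subgroup (W k) R" "\<And>k. W k \<subseteq> \<I> k"
    and mult: "\<And>i j a w. a \<in> \<I> i \<Longrightarrow> w \<in> W j \<Longrightarrow> a \<otimes> w \<in> W (i + j)"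
  shows "ideal {p \<in> carrier (UP R). \<forall>k. up_ring.coeff (UP R) p k \<in> W k} (rees_algebra R \<I>)"
    (is "ideal ?J ?S")
proof -
  note in_W = finsum_in_additive_subgroup[OF W(1)]
  interpret UP_cring R "UP R" by unfold_locales
  interpret S: noetherian_ring ?S by (rule rees_noetherian)
  have sub: "?J \<subseteq> carrier ?S" using W(2) by (auto simp: rees_algebra_simps)
  \<comment> \<open>The negative in \<open>?S\<close> refers to the carrier of \<open>?S\<close>, so
    it must be identified with the one in \<open>UP R\<close>.\<close>
  have inv: "\<ominus>\<^bsub>?S\<^esub> p = \<ominus>\<^bsub>UP R\<^esub> p" if "p \<in> carrier ?S" for p
  proof (rule S.minus_equality)
    show "\<ominus>\<^bsub>UP R\<^esub> p \<oplus>\<^bsub>?S\<^esub> p = \<zero>\<^bsub>?S\<^esub>"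
      using that by (simp add: rees_algebra_simps P.l_neg)
    show "\<ominus>\<^bsub>UP R\<^esub> p \<in> carrier ?S"
      using that additive_subgroup.a_inv_closed[OF filtration_subgroup] by (simp add: rees_algebra_simps)
  qed (rule that)
  have "additive_subgroup ?J ?S"
  proof (rule S.additive_subgroup_criterion)
    show "\<ominus>\<^bsub>?S\<^esub> p \<in> ?J" if "p \<in> ?J" for p
      using that inv[of p] sub additive_subgroup.a_inv_closed[OF W(1)] by auto
  qed (use sub W(1) in \<open>auto simp: rees_algebra_simps additive_subgroup.zero_closed additive_subgroup.a_closed\<close>)
  moreover have closed: "x \<otimes>\<^bsub>UP R\<^esub> p \<in> ?J" if "p \<in> ?J" "x \<in> carrier ?S" for p x
  proof -
    have "(\<Oplus>i \<in> {..k}. up_ring.coeff (UP R) x i \<otimes> up_ring.coeff (UP R) p (k - i)) \<in> W k" for k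
    proof (rule in_W)
      fix i assume "i \<in> {..k}"
      then show "up_ring.coeff (UP R) x i \<otimes> up_ring.coeff (UP R) p (k - i) \<in> W k"
        using mult[of "up_ring.coeff (UP R) x i" i "up_ring.coeff (UP R) p (k - i)" "k - i"] that
        by (simp add: rees_algebra_simps)
    qed
    then show ?thesis using that by (simp add: rees_algebra_simps)
  qed
  moreover have "p \<otimes>\<^bsub>UP R\<^esub> x \<in> ?J" if "p \<in> ?J" "x \<in> carrier ?S" for p x
    using closed[OF that] UP_m_comm[of p x] that by (simp add: rees_algebra_simps)
  ultimately show ?thesis
    by (intro idealI S.ring_axioms additive_subgroup.a_subgroup)
      (auto simp: rees_algebra_simps)
qed

text \<open>If \<open>x\<close> lies in every \<open>\<I> k\<close>, the ideals generated by \<open>x, x t, \<dots>, x t\<^sup>n\<close> in the Rees algebra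
  stabilise, and comparing coefficients of a high power of \<open>t\<close> puts \<open>\<one>\<close> into \<open>\<I> 1\<close>.
  The truncated subtraction \<open>k - n\<close> is intended: for \<open>k \<le> n\<close> the coefficient ideal is all of \<open>x R\<close>.\<close>

lemma filtration_separated:
  assumes x: "\<And>k. x \<in> \<I> k"
  shows "x = \<zero>"
proof (rule ccontr)
  assume nz: "x \<noteq> \<zero>"
  have xc: "x \<in> carrier R" using x filtration_carrier by blast
  define W where "W n k = (\<otimes>) x ` \<I> (k - n)" for n k
  define J where "J n = {p \<in> carrier (UP R). \<forall>k. up_ring.coeff (UP R) p k \<in> W n k}" for n
  have sub: "additive_subgroup (W n k) R" for n k
  proof -
    interpret I: ideal "\<I> (k - n)" R by (rule filtration_ideal)
    show ?thesis
    proof (rule additive_subgroup_criterion)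
      show "\<zero> \<in> W n k" unfolding W_def
        by (rule image_eqI[of _ _ \<zero>]) (use xc in auto)
      show "a \<oplus> b \<in> W n k" if "a \<in> W n k" "b \<in> W n k" for a b
        using that xc by (auto simp: W_def r_distr[symmetric])
      show "\<ominus> a \<in> W n k" if "a \<in> W n k" for a
        using that xc by (auto simp: W_def r_minus[symmetric])
    qed (use xc in \<open>auto simp: W_def\<close>)
  qed
  have W_le: "W n k \<subseteq> \<I> k" for n k
  proof -
    have "x \<otimes> a \<in> \<I> k" if "a \<in> \<I> (k - n)" for a
      using filtration_m_closed[OF x[of n] that] by (rule filtration_antimonoD) simp
    then show ?thesis by (auto simp: W_def)
  qed
  have mult: "a \<otimes> w \<in> W n (i + j)" if a: "a \<in> \<I> i" and w: "w \<in> W n j" for a w i j n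
  proof -
    obtain b where b: "b \<in> \<I> (j - n)" "w = x \<otimes> b" using w by (auto simp: W_def)
    have "a \<otimes> b \<in> \<I> (i + j - n)"
      using filtration_m_closed[OF a b(1)] by (rule filtration_antimonoD) simp
    moreover have "a \<otimes> w = x \<otimes> (a \<otimes> b)"
      using b a filtration_carrier xc by (simp add: m_lcomm)
    ultimately show ?thesis by (auto simp: W_def)
  qed
  have "ideal (J n) (rees_algebra R \<I>)" for n
    unfolding J_def using sub W_le mult by (rule ideal_rees_algebra)
  moreover have "J n \<subseteq> J (Suc n)" for n
  proof -
    have "W n k \<subseteq> W (Suc n) k" for k
      unfolding W_def by (intro image_mono filtration_antimono) simp
    then show ?thesis by (auto simp: J_def)
  qed
  ultimately obtain n where "\<forall>i\<ge>n. J i = J n"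
    using noetherian_ring.ascending_ideals_stabilise[OF rees_noetherian] by blast
  then have J: "J (Suc n) = J n" using le_SucI[OF order_refl] by blast
  have zero: "\<zero> \<in> W n k" for n k using additive_subgroup.zero_closed[OF sub] .
  have "x \<in> W (Suc n) (Suc n)" unfolding W_def
    by (rule image_eqI[of _ _ \<one>]) (use xc in \<open>auto simp: filtration_0\<close>)
  then have "up_ring.monom (UP R) x (Suc n) \<in> J (Suc n)"
    using xc zero by (simp add: J_def UP_monom)
  then have "up_ring.monom (UP R) x (Suc n) \<in> J n" by (simp only: J)
  then have "up_ring.coeff (UP R) (up_ring.monom (UP R) x (Suc n)) (Suc n) \<in> W n (Suc n)"
    unfolding J_def by blast
  \<comment> \<open>\<open>Suc n - n = 1\<close> puts \<open>b\<close> into \<open>\<I> 1\<close>;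
    cancelling \<open>x\<close> then forces \<open>b = \<one>\<close>.\<close>
  then obtain b where b: "b \<in> \<I> 1" "x = x \<otimes> b" using xc by (auto simp: W_def UP_monom)
  then have "b = \<one>"
    using m_lcancel[OF nz xc, of b \<one>] filtration_carrier xc by simp
  then show False
    using proper[of 1] b(1) proper_ideal_iff_one[OF filtration_ideal] by simp
qed

text \<open>A triple \<open>(g, m, d)\<close> stands for the generator \<open>g t\<^sup>m\<close>, with \<open>g\<close> homogeneous of degree \<open>d\<close>, of the
  ideal of elements of positive \<open>t\<close>-degree of the Rees algebra. That \<open>\<I> k\<close> is contained in the sum of
  the \<open>g \<I> (k - m)\<close> is stated by quantifying over the additive subgroups containing these products.\<close>

definition positive_generators :: "('a \<times> nat \<times> nat) set \<Rightarrow> bool" where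
  "positive_generators T \<longleftrightarrow> finite T \<and> (\<forall>(g, m, d) \<in> T. 1 \<le> m \<and> g \<in> \<I> m \<and> g \<in> G d \<and> g \<noteq> \<zero>) \<and>
     (\<forall>k\<ge>1. \<forall>H. additive_subgroup H R \<longrightarrow>
        (\<forall>(g, m, d) \<in> T. m \<le> k \<longrightarrow> (\<forall>a \<in> \<I> (k - m). a \<otimes> g \<in> H)) \<longrightarrow> \<I> k \<subseteq> H)"

text \<open>A finite generating set \<open>A\<close> of the ideal \<open>J\<close> is split into
  pieces homogeneous in both gradings. The smallest admissible subgroups \<open>W k\<close> define,
  coefficientwise, an ideal containing \<open>A\<close>, hence \<open>J\<close>, which gives
  \<open>\<I> k \<subseteq> W k\<close> for \<open>k \<ge> 1\<close>.\<close>

lemma exists_positive_generators: "\<exists>T. positive_generators T"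
proof -
  let ?S = "rees_algebra R \<I>"
  let ?c = "up_ring.coeff (UP R)"
  interpret S: noetherian_ring ?S by (rule rees_noetherian)
  define J where "J = {p \<in> carrier (UP R). \<forall>k. ?c p k \<in> (if k = 0 then {\<zero>} else \<I> k)}"
  have "ideal J ?S"
    unfolding J_def
  proof (rule ideal_rees_algebra)
    show "additive_subgroup (if k = 0 then {\<zero>} else \<I> k) R" for k
      using filtration_subgroup ideal.axioms(1)[OF zeroideal] by simp
    show "(if k = 0 then {\<zero>} else \<I> k) \<subseteq> \<I> k" for k
      using additive_subgroup.zero_closed[OF filtration_subgroup] by auto
    show "a \<otimes> w \<in> (if i + j = 0 then {\<zero>} else \<I> (i + j))"
      if "a \<in> \<I> i" "w \<in> (if j = 0 then {\<zero>} else \<I> j)" for i j a w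
      using that filtration_m_closed filtration_carrier additive_subgroup.zero_closed[OF filtration_subgroup]
      by (auto split: if_splits)
  qed
  then obtain A where A: "A \<subseteq> carrier ?S" "finite A" "J = Idl\<^bsub>?S\<^esub> A"
    using S.finetely_gen by blast
  \<comment> \<open>Coefficients at 0 vanish on \<open>J\<close>, and those above
    \<open>deg R p\<close> vanish anyway, so no nonzero piece is omitted.\<close>
  define T where "T = (\<Union>p \<in> A. \<Union>k \<in> {1..deg R p}.
    (\<lambda>d. (component (?c p k) d, k, d)) ` {d. component (?c p k) d \<noteq> \<zero>})"
  have AJ: "A \<subseteq> J" using A S.genideal_self by simp
  have coeff_A: "?c p k \<in> \<I> k" "?c p k \<in> carrier R" "p \<in> carrier (UP R)" if "p \<in> A" for p k
    using that A(1) filtration_carrier by (auto simp: rees_algebra_simps)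
  have "finite T"
    unfolding T_def using A(2) coeff_A finite_components by (intro finite_UN_I finite_imageI) auto
  moreover have T: "1 \<le> m \<and> g \<in> \<I> m \<and> g \<in> G d \<and> g \<noteq> \<zero>" if "(g, m, d) \<in> T" for g m d
    using that coeff_A filtration_component component_grade by (auto simp: T_def)
  moreover have "\<I> k \<subseteq> H" if "1 \<le> k" and "additive_subgroup H R"
      and "\<forall>(g, m, d) \<in> T. m \<le> k \<longrightarrow> (\<forall>a \<in> \<I> (k - m). a \<otimes> g \<in> H)" for k H
  proof -
    \<comment> \<open>The family is formed at every index, although \<open>H\<close> concerns a
      single one, because the ideal property of \<open>W\<close> relates different indices.\<close>
    define F where "F k = {H. additive_subgroup H R \<and>
      (\<forall>(g, m, d) \<in> T. m \<le> k \<longrightarrow> (\<forall>a \<in> \<I> (k - m). a \<otimes> g \<in> H))}" for k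
    define W where "W k = \<Inter>(F k)" for k
    have "\<I> k \<in> F k" for k
    proof -
      have "a \<otimes> g \<in> \<I> k" if "(g, m, d) \<in> T" "m \<le> k" "a \<in> \<I> (k - m)" for g m d a
        using filtration_m_closed[OF that(3), of g m] T[OF that(1)] that(2) by simp
      then show ?thesis using filtration_subgroup by (auto simp: F_def)
    qed
    then have W_le: "W k \<subseteq> \<I> k" for k by (auto simp: W_def)
    have FD: "additive_subgroup H R" if "H \<in> F k" for H k using that by (simp add: F_def)
    have sub: "additive_subgroup (W k) R" for k
    proof (rule additive_subgroup_criterion)
      show "W k \<subseteq> carrier R" using W_le filtration_carrier by blast
    qed (use FD in \<open>auto simp: W_def additive_subgroup.zero_closed additive_subgroup.a_closed
           additive_subgroup.a_inv_closed\<close>)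
    have mult: "b \<otimes> w \<in> W (i + j)" if b: "b \<in> \<I> i" and w: "w \<in> W j" for b w i j
      unfolding W_def
    proof
      fix H assume H: "H \<in> F (i + j)"
      interpret H: additive_subgroup H R using FD H .
      have bc: "b \<in> carrier R" using b filtration_carrier by blast
      \<comment> \<open>The preimage of \<open>H\<close> under multiplication by \<open>b\<close> is
        admissible at index \<open>j\<close>, hence contains \<open>W j\<close>.\<close>
      have "{w \<in> carrier R. b \<otimes> w \<in> H} \<in> F j"
      proof -
        have "additive_subgroup {w \<in> carrier R. b \<otimes> w \<in> H} R"
          by (rule additive_subgroup_criterion) (use bc in \<open>auto simp: r_distr r_minus\<close>)
        moreover have "b \<otimes> (a \<otimes> g) \<in> H \<and> a \<otimes> g \<in> carrier R"
          if t: "(g, m, d) \<in> T" and "m \<le> j" and a: "a \<in> \<I> (j - m)" for g m d a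
        proof -
          have c: "a \<in> carrier R" "g \<in> carrier R" using a T[OF t] filtration_carrier by auto
          have "b \<otimes> a \<in> \<I> (i + j - m)"
            using filtration_m_closed[OF b a] \<open>m \<le> j\<close> by simp
          then have "b \<otimes> a \<otimes> g \<in> H"
            using H t \<open>m \<le> j\<close> by (fastforce simp: F_def)
          then show ?thesis using bc c by (simp add: m_assoc)
        qed
        ultimately show ?thesis by (auto simp: F_def)
      qed
      then show "b \<otimes> w \<in> H" using w by (auto simp: W_def)
    qed
    have "?c p k \<in> W k" if p: "p \<in> A" for p k
    proof (cases "1 \<le> k \<and> k \<le> deg R p")
      case True
      have "component (?c p k) d \<in> H" if H: "H \<in> F k" for d H
      proof (cases "component (?c p k) d = \<zero>")
        case True
        then show ?thesis using additive_subgroup.zero_closed[OF FD[OF H]] by simp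
      next
        case False
        then have "(component (?c p k) d, k, d) \<in> T"
          unfolding T_def by (intro UN_I[of p] UN_I[of k] imageI) (use p True in auto)
        \<comment> \<open>A generator with \<open>m = k\<close> lies in \<open>H\<close> itself,
          through the multiplier \<open>\<one>\<close> in \<open>\<I> 0\<close>.\<close>
        then have "\<one> \<otimes> component (?c p k) d \<in> H"
          using H by (fastforce simp: F_def filtration_0)
        then show ?thesis using component_closed coeff_A(2)[OF p] by simp
      qed
      then have "component (?c p k) d \<in> W k" for d by (simp add: W_def)
      then show ?thesis
        by (subst sum_components[OF coeff_A(2)[OF p]]) (rule finsum_in_additive_subgroup[OF sub])
    next
      case False
      then have "k = 0 \<or> deg R p < k" by auto
      then have "?c p k = \<zero>"
      proof
        assume "k = 0"
        moreover have "p \<in> J" using AJ p by blast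
        ultimately show ?thesis by (auto simp: J_def split: if_splits)
      next
        assume "deg R p < k"
        then show ?thesis using UP_ring.deg_aboveD[OF UP_ring] coeff_A(3)[OF p] by blast
      qed
      then show ?thesis using additive_subgroup.zero_closed[OF sub] by simp
    qed
    then have "A \<subseteq> {p \<in> carrier (UP R). \<forall>k. ?c p k \<in> W k}" using coeff_A by blast
    then have J_le: "J \<subseteq> {p \<in> carrier (UP R). \<forall>k. ?c p k \<in> W k}"
      unfolding A(3) by (intro S.genideal_minimal ideal_rees_algebra sub W_le mult)
    have "\<I> k \<subseteq> W k"
    proof
      fix h assume h: "h \<in> \<I> k"
      then have hc: "h \<in> carrier R" using filtration_carrier by blast
      then have "up_ring.monom (UP R) h k \<in> J"
        using h \<open>1 \<le> k\<close> additive_subgroup.zero_closed[OF filtration_subgroup] by (auto simp: J_def UP_monom)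
      then have "?c (up_ring.monom (UP R) h k) k \<in> W k" using J_le by blast
      then show "h \<in> W k" using hc by (simp add: UP_monom)
    qed
    moreover have "H \<in> F k" using that by (simp add: F_def)
    ultimately show ?thesis by (auto simp: W_def)
  qed
  ultimately have "positive_generators T"
    unfolding positive_generators_def by blast
  then show ?thesis ..
qed

lemma positive_generatorsD:
  assumes "positive_generators T"
  shows "finite T"
    and "(g, m, d) \<in> T \<Longrightarrow> 1 \<le> m \<and> g \<in> \<I> m \<and> g \<in> G d \<and> g \<noteq> \<zero>"
    and "\<lbrakk>1 \<le> k; additive_subgroup H R;
       \<And>g m d a. \<lbrakk>(g, m, d) \<in> T; m \<le> k; a \<in> \<I> (k - m)\<rbrakk> \<Longrightarrow> a \<otimes> g \<in> H\<rbrakk> \<Longrightarrow> \<I> k \<subseteq> H"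
  using assms unfolding positive_generators_def by blast+

section \<open>The slope of the initial degrees\<close>

text \<open>A product \<open>a \<otimes> g\<close> with nonzero part in degree \<open>e\<close>
  satisfies \<open>\<rho> * (k - m) \<le> e - d\<close> by induction and
  \<open>\<rho> * m \<le> d\<close> by the slope condition; the two add up.\<close>

lemma degree_lower_bound:
  fixes \<rho> :: real
  assumes T: "positive_generators T" and slope: "\<And>g m d. (g, m, d) \<in> T \<Longrightarrow> \<rho> * m \<le> d"
    and h: "h \<in> \<I> k" "h \<in> G e" "h \<noteq> \<zero>"
  shows "\<rho> * k \<le> e"
  using h
proof (induction k arbitrary: h e rule: less_induct)
  case (less k)
  show ?case
  proof (rule ccontr)
    assume lt: "\<not> \<rho> * k \<le> e"
    then have k: "1 \<le> k" by (cases k) auto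
    \<comment> \<open>If the bound fails, no product \<open>a \<otimes> g\<close> has a part in
      degree \<open>e\<close>, so \<open>\<I> k\<close> lies in \<open>?H\<close>; but
      \<open>h\<close> is its own part in degree \<open>e\<close>.\<close>
    let ?H = "{w \<in> carrier R. component w e = \<zero>}"
    have "\<I> k \<subseteq> ?H"
    proof (rule positive_generatorsD(3)[OF T k])
      show "additive_subgroup ?H R"
        by (rule additive_subgroup_criterion)
          (auto simp: component_zero component_add component_minus)
    next
      fix g m d a assume t: "(g, m, d) \<in> T" and m: "m \<le> k" and a: "a \<in> \<I> (k - m)"
      have g: "1 \<le> m" "g \<in> G d" using positive_generatorsD(2)[OF T t] by auto
      have c: "a \<in> carrier R" "g \<in> carrier R" using a g filtration_carrier grade_carrier by auto
      have "component a (e - d) = \<zero>" if "d \<le> e"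
      proof (rule ccontr)
        assume "component a (e - d) \<noteq> \<zero>"
        then have "\<rho> * real (k - m) \<le> real (e - d)"
          using less.IH[of "k - m" "component a (e - d)" "e - d"] k g(1) m
            filtration_component[OF a] component_grade[OF c(1)] by simp
        moreover have "real (k - m) = real k - real m" "real (e - d) = real e - real d"
          using m that by (auto simp: of_nat_diff)
        ultimately have "\<rho> * real k \<le> real e"
          using slope[OF t] by (simp add: right_diff_distrib)
        then show False using lt by simp
      qed
      then show "a \<otimes> g \<in> ?H"
        using c by (simp add: component_mult_homogeneous[OF c(1) g(2)])
    qed
    then show False
      using less.prems component_homogeneous[of h e e] by auto
  qed
qed

text \<open>The elements of degree 0 of \<open>\<I> k\<close> lie in the ideal generated by the monomials
  of weight \<open>k\<close> in the generators of degree 0.\<close>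

lemma degree_zero_part_le:
  assumes T: "positive_generators T" and Z: "Z = {t \<in> T. snd (snd t) = 0}"
    and Q: "ideal Q R"
    and mono: "\<And>e. (\<Sum>t\<in>Z. e t * fst (snd t)) = k \<Longrightarrow> (\<Otimes>t\<in>Z. fst t [^] (e t :: nat)) \<in> Q"
  shows "\<I> k \<inter> G 0 \<subseteq> Q"
  using Q mono
\<comment> \<open>\<open>Q\<close> varies because the hypothesis is applied to the colon ideal
  \<open>(Q : g)\<close>.\<close>
proof (induction k arbitrary: Q rule: less_induct)
  case (less k)
  interpret Q: ideal Q R by (rule less.prems(1))
  have Zc: "fst t \<in> carrier R" if "t \<in> Z" for t
    by (cases t) (use that positive_generatorsD(2)[OF T] filtration_carrier in \<open>fastforce simp: Z\<close>)
  have fin: "finite Z" using positive_generatorsD(1)[OF T] by (simp add: Z)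
  show ?case
  proof (cases "k = 0")
    case True
    then have "\<one> \<in> Q" using less.prems(2)[of "\<lambda>_. 0"] by simp
    then show ?thesis using Q.one_imp_carrier grade_carrier by auto
  next
    case False
    \<comment> \<open>Only generators of degree 0 matter: for \<open>d > 0\<close> the degree 0
      component of \<open>a \<otimes> g\<close> is zero.\<close>
    let ?H = "{w \<in> carrier R. component w 0 \<in> Q}"
    have "\<I> k \<subseteq> ?H"
    proof (rule positive_generatorsD(3)[OF T])
      show "1 \<le> k" using False by simp
      show "additive_subgroup ?H R"
        by (rule additive_subgroup_criterion)
          (auto simp: component_zero component_add component_minus)
    next
      fix g m d a assume t: "(g, m, d) \<in> T" and m: "m \<le> k" and a: "a \<in> \<I> (k - m)"
      have g: "1 \<le> m" "g \<in> G d" using positive_generatorsD(2)[OF T t] by auto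
      have c: "a \<in> carrier R" "g \<in> carrier R" using a g filtration_carrier grade_carrier by auto
      have "component a 0 \<otimes> g \<in> Q" if "d = 0"
      proof -
        let ?t = "(g, m, d)"
        have tZ: "?t \<in> Z" using t that by (simp add: Z)
        have "\<I> (k - m) \<inter> G 0 \<subseteq> ideal_colon R Q g"
        proof (rule less.IH)
          show "k - m < k" using False g(1) by simp
          show "ideal (ideal_colon R Q g) R" by (rule ideal_ideal_colon[OF Q.is_ideal c(2)])
        next
          fix e :: "'a \<times> nat \<times> nat \<Rightarrow> nat" assume e: "(\<Sum>t\<in>Z. e t * fst (snd t)) = k - m"
          \<comment> \<open>Raising the exponent at \<open>?t\<close> by one adds \<open>m\<close>
            to the weight and a factor \<open>g\<close> to the monomial.\<close>
          let ?e = "\<lambda>s. e s + (if s = ?t then 1 else 0)"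
          have "(\<Sum>s\<in>Z. ?e s * fst (snd s)) = (\<Sum>s\<in>Z. e s * fst (snd s) + (if s = ?t then m else 0))"
            by (rule sum.cong) auto
          also have "\<dots> = k" using e m fin tZ by (simp add: sum.distrib)
          finally have "(\<Otimes>s\<in>Z. fst s [^] ?e s) \<in> Q" by (rule less.prems(2))
          moreover have "(\<Otimes>s\<in>Z. fst s [^] ?e s) =
              (\<Otimes>s\<in>Z. fst s [^] e s \<otimes> (if s = ?t then fst s else \<one>))"
            by (rule finprod_cong') (use Zc in auto)
          moreover have "\<dots> = (\<Otimes>s\<in>Z. fst s [^] e s) \<otimes> (\<Otimes>s\<in>Z. if s = ?t then fst s else \<one>)"
            by (rule finprod_multf) (use Zc in auto)
          moreover have "(\<Otimes>s\<in>Z. if s = ?t then fst s else \<one>) = g"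
            using finprod_singleton_swap[OF tZ fin, of fst] Zc by auto
          moreover have "(\<Otimes>s\<in>Z. fst s [^] e s) \<in> carrier R"
            by (rule finprod_closed) (use Zc in auto)
          ultimately show "(\<Otimes>s\<in>Z. fst s [^] e s) \<in> ideal_colon R Q g"
            by (simp add: ideal_colon_def)
        qed
        then show ?thesis
          using filtration_component[OF a] component_grade[OF c(1)] by (auto simp: ideal_colon_def)
      qed
      then show "a \<otimes> g \<in> ?H"
        using c by (simp add: component_mult_homogeneous[OF c(1) g(2)])
    qed
    then show ?thesis using component_homogeneous[of _ 0 0] by auto
  qed
qed

text \<open>Otherwise every monomial of large weight \<open>k\<close> in the generators of degree 0 lies in
  \<open>\<I> (k + 1)\<close>, so the degree 0 part of the filtration is eventually constant.\<close>

lemma exists_degree_zero_generator: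
  assumes T: "positive_generators T" and ex: "(g, m, 0) \<in> T"
  shows "\<exists>g m. (g, m, 0) \<in> T \<and> (\<forall>j::nat. g [^] j \<notin> \<I> (Suc (j * m)))"
proof (rule ccontr)
  define Z where "Z = {t \<in> T. snd (snd t) = 0}"
  have fin: "finite Z" using positive_generatorsD(1)[OF T] by (simp add: Z_def)
  have Z: "fst t \<in> \<I> (fst (snd t))" if "t \<in> Z" for t
    by (cases t) (use that positive_generatorsD(2)[OF T] in \<open>fastforce simp: Z_def\<close>)
  assume "\<not> ?thesis"
  then have "\<forall>t\<in>Z. \<exists>j::nat. fst t [^] j \<in> \<I> (Suc (j * fst (snd t)))"
    by (auto simp: Z_def)
  then obtain J :: "_ \<Rightarrow> nat" where J: "\<And>t. t \<in> Z \<Longrightarrow> fst t [^] J t \<in> \<I> (Suc (J t * fst (snd t)))"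
    by metis
  \<comment> \<open>A monomial whose exponents are all bounded by \<open>J\<close> has weight below
    \<open>N\<close>.\<close>
  define N where "N = Suc (\<Sum>t\<in>Z. J t * fst (snd t))"
  have step: "\<I> k \<inter> G 0 \<subseteq> \<I> (Suc k)" if k: "N \<le> k" for k
  proof (rule degree_zero_part_le[OF T Z_def filtration_ideal])
    fix e :: "'a \<times> nat \<times> nat \<Rightarrow> nat" assume e: "(\<Sum>t\<in>Z. e t * fst (snd t)) = k"
    have "\<exists>t\<in>Z. J t < e t"
    proof (rule ccontr)
      assume "\<not> ?thesis"
      then have "(\<Sum>t\<in>Z. e t * fst (snd t)) \<le> (\<Sum>t\<in>Z. J t * fst (snd t))"
        by (intro sum_mono mult_right_mono) (auto simp: not_less)
      then show False using e k by (simp add: N_def)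
    qed
    then obtain s where s: "s \<in> Z" "J s < e s" by blast
    \<comment> \<open>The factor at \<open>s\<close> is divisible by \<open>fst s [^] J s\<close>
      and so gains one extra filtration step.\<close>
    let ?n = "\<lambda>t. e t * fst (snd t) + (if t = s then 1 else 0)"
    have "(\<Otimes>t\<in>Z. fst t [^] e t) \<in> \<I> (\<Sum>t\<in>Z. ?n t)"
    proof (rule filtration_finprod[OF fin])
      fix t assume t: "t \<in> Z"
      have c: "fst t \<in> carrier R" using Z[OF t] filtration_carrier by blast
      show "fst t [^] e t \<in> \<I> (?n t)"
      proof (cases "t = s")
        case True
        have "fst s [^] J s \<otimes> fst s [^] (e s - J s)
            \<in> \<I> (Suc (J s * fst (snd s)) + (e s - J s) * fst (snd s))"
          by (rule filtration_m_closed[OF J[OF s(1)] filtration_nat_pow[OF Z[OF s(1)]]])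
        moreover have "fst s [^] J s \<otimes> fst s [^] (e s - J s) = fst s [^] e s"
          using nat_pow_mult[of "fst s" "J s" "e s - J s"] c s(2) True by simp
        moreover have "Suc (J s * fst (snd s)) + (e s - J s) * fst (snd s) = ?n s"
          using s(2) by (simp add: add_mult_distrib[symmetric])
        ultimately show ?thesis using True by simp
      next
        case False
        then show ?thesis using filtration_nat_pow[OF Z[OF t]] by simp
      qed
    qed
    moreover have "(\<Sum>t\<in>Z. ?n t) = Suc k" using e fin s(1) by (simp add: sum.distrib)
    ultimately show "(\<Otimes>t\<in>Z. fst t [^] e t) \<in> \<I> (Suc k)" by simp
  qed
  \<comment> \<open>A nonzero element of degree 0 in \<open>\<I> N\<close>, since
    \<open>N \<le> N * m\<close>; \<open>step\<close> carries it into all later ideals.\<close>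
  let ?x = "g [^] N"
  have g: "1 \<le> m" "g \<in> \<I> m" "g \<in> G 0" "g \<noteq> \<zero>" using positive_generatorsD(2)[OF T ex] by auto
  have x0: "?x \<in> G 0" using grade_pow[OF g(3), of N] by simp
  have xN: "?x \<in> \<I> N"
    using filtration_nat_pow[OF g(2), of N] by (rule filtration_antimonoD) (use g(1) in simp)
  have "?x \<in> \<I> k" if "N \<le> k" for k
    using that by (induction k rule: dec_induct) (use xN x0 step in auto)
  then have "?x \<in> \<I> k" for k
    using filtration_antimonoD[of ?x "max k N" k] by simp
  then have "?x = \<zero>" by (rule filtration_separated)
  then show False using nat_pow_nonzero g(4) grade_carrier[OF g(3)] by blast
qed

lemma exists_slope:
  "\<exists>(\<rho>::real) f m d. 1 \<le> m \<and> f \<in> \<I> m \<and> f \<in> G d \<and> real d = \<rho> * real m \<and>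
     (\<forall>j::nat. f [^] j \<notin> \<I> (Suc (j * m))) \<and>
     (\<forall>k e h. h \<in> \<I> k \<longrightarrow> h \<in> G e \<longrightarrow> h \<noteq> \<zero> \<longrightarrow> \<rho> * real k \<le> real e)"
proof -
  obtain T where T: "positive_generators T" using exists_positive_generators by blast
  have "T \<noteq> {}"
  proof
    assume "T = {}"
    then have "\<I> 1 \<subseteq> {\<zero>}"
      using positive_generatorsD(3)[OF T, of 1 "{\<zero>}"] ideal.axioms(1)[OF zeroideal] by simp
    then show False
      using nonzero[of 1] additive_subgroup.zero_closed[OF filtration_subgroup, of 1] by auto
  qed
  define s where "s = (\<lambda>t :: 'a \<times> nat \<times> nat. real (snd (snd t)) / real (fst (snd t)))"
  define \<rho> where "\<rho> = Min (s ` T)"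
  have fin: "finite (s ` T)" "s ` T \<noteq> {}" using positive_generatorsD(1)[OF T] \<open>T \<noteq> {}\<close> by auto
  have slope: "\<rho> * m \<le> d" if t: "(g, m, d) \<in> T" for g m d
  proof -
    have "\<rho> \<le> s (g, m, d)" unfolding \<rho>_def using fin t by simp
    then show ?thesis using positive_generatorsD(2)[OF T t] by (simp add: s_def le_divide_eq)
  qed
  have lower: "\<rho> * k \<le> e" if "h \<in> \<I> k" "h \<in> G e" "h \<noteq> \<zero>" for h k e
    using degree_lower_bound[OF T _ that] slope by blast
  have "\<rho> \<in> s ` T" unfolding \<rho>_def using fin by (rule Min_in)
  then obtain g m d where t: "(g, m, d) \<in> T" and "\<rho> = s (g, m, d)" by auto
  then have d: "real d = \<rho> * real m"
    using positive_generatorsD(2)[OF T t] by (simp add: s_def)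
  have g: "1 \<le> m" "g \<in> \<I> m" "g \<in> G d" "g \<noteq> \<zero>" using positive_generatorsD(2)[OF T t] by auto
  show ?thesis
  proof (cases "d = 0")
    case False
    then have pos: "\<rho> > 0" using d g(1) zero_less_mult_pos2[of \<rho> "real m"] by simp
    \<comment> \<open>The degree of \<open>g [^] j\<close> is exactly
      \<open>\<rho> * (j * m)\<close>, too small for the next filtration index.\<close>
    have "g [^] j \<notin> \<I> (Suc (j * m))" for j :: nat
    proof
      assume "g [^] j \<in> \<I> (Suc (j * m))"
      then have "\<rho> * real (Suc (j * m)) \<le> real (j * d)"
        by (rule lower[OF _ grade_pow[OF g(3)] nat_pow_nonzero[OF grade_carrier[OF g(3)] g(4)]])
      also have "\<dots> = \<rho> * real (j * m)" using d by simp
      finally show False using pos by (simp add: mult_le_cancel_left)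
    qed
    then show ?thesis using g d lower by blast
  next
    case True
    then have "\<rho> = 0" using d g(1) by simp
    \<comment> \<open>The minimiser \<open>g\<close> may have to be exchanged; every generator of
      degree 0 attains the slope 0.\<close>
    obtain g' m' where g': "(g', m', 0) \<in> T" "\<forall>j::nat. g' [^] j \<notin> \<I> (Suc (j * m'))"
      using exists_degree_zero_generator[OF T] t True by blast
    moreover have "real 0 = \<rho> * real m'" using \<open>\<rho> = 0\<close> by simp
    ultimately show ?thesis using positive_generatorsD(2)[OF T g'(1)] lower by blast
  qed
qed

section \<open>Bounding the v-number\<close>

text \<open>One witness for the stable colon ideal serves all large \<open>j\<close>, so its degree
  \<open>e\<close> does not depend on \<open>j\<close>; the factor \<open>f [^] j\<close> adds
  \<open>j * d\<close>.\<close>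

lemma eventually_prime_colon:
  assumes f: "f \<in> \<I> m" "f \<in> G d" and not_in: "\<And>j::nat. f [^] j \<notin> \<I> (Suc (j * m))"
    and c: "1 \<le> c"
  shows "\<exists>e J. \<forall>j\<ge>J. \<exists>g \<in> G (j * d + e). primeideal (ideal_colon R (\<I> (j * m + c)) g) R"
proof -
  have fc: "f \<in> carrier R" using f(1) filtration_carrier by blast
  define C where "C j = ideal_colon R (\<I> (j * m + c)) (f [^] (j::nat))" for j
  have graded: "graded_ideal (C j) R G" for j
    unfolding C_def using grade_pow[OF f(2)] by (rule graded_ideal.graded_ideal_colon[OF filtration_graded])
  then have ideal: "ideal (C j) R" for j by (rule graded_ideal.axioms)
  have "C j \<subseteq> C (Suc j)" for j
  proof
    fix r assume "r \<in> C j"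
    then have r: "r \<in> carrier R" "r \<otimes> f [^] j \<in> \<I> (j * m + c)" by (auto simp: C_def ideal_colon_def)
    have "(r \<otimes> f [^] j) \<otimes> f \<in> \<I> (j * m + c + m)" using filtration_m_closed[OF r(2) f(1)] .
    then show "r \<in> C (Suc j)" using r fc by (simp add: C_def ideal_colon_def m_assoc add_ac)
  qed
  then obtain J where J: "\<forall>j\<ge>J. C j = C J"
    using ascending_ideals_stabilise[of C] ideal by blast
  have "\<one> \<notin> C J"
  proof
    assume "\<one> \<in> C J"
    then have "f [^] J \<in> \<I> (J * m + c)" using fc by (simp add: C_def ideal_colon_def)
    then have "f [^] J \<in> \<I> (Suc (J * m))" by (rule filtration_antimonoD) (use c in simp)
    then show False using not_in by blast
  qed
  then have "C J \<noteq> carrier R" by auto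
  then obtain e g where g: "g \<in> G e" "primeideal (ideal_colon R (C J) g) R"
    using graded_ideal.exists_homogeneous_prime_colon[OF graded] noetherian_ring_axioms by blast
  have "g \<otimes> f [^] j \<in> G (j * d + e)
      \<and> primeideal (ideal_colon R (\<I> (j * m + c)) (g \<otimes> f [^] j)) R" if "J \<le> j" for j
  proof -
    have "ideal_colon R (C j) g = ideal_colon R (\<I> (j * m + c)) (g \<otimes> f [^] j)"
      unfolding C_def by (rule ideal_colon_mult[OF filtration_ideal]) (use fc g(1) grade_carrier in auto)
    moreover have "C j = C J" using J that by blast
    ultimately show ?thesis
      using g grade_mult[OF g(1) grade_pow[OF f(2), of j]] by (simp add: add.commute)
  qed
  then show ?thesis by blast
qed

lemma v_number_le:
  assumes "g \<in> G e" and "primeideal (ideal_colon R (\<I> k) g) R"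
  shows "v_number R G (\<I> k) \<le> e"
  unfolding v_number_def
  using prime_colon_is_associated[OF filtration_ideal _ assms(2)] grade_carrier[OF assms(1)] assms(1)
  by (intro Least_le) blast

lemma v_number_witness:
  assumes "1 \<le> k"
  obtains g where "g \<in> G (v_number R G (\<I> k))" and "primeideal (ideal_colon R (\<I> k) g) R"
proof -
  obtain e g where g: "g \<in> G e" "primeideal (ideal_colon R (\<I> k) g) R"
    using graded_ideal.exists_homogeneous_prime_colon[OF filtration_graded noetherian_ring_axioms]
      proper[OF assms] by blast
  then have "\<exists>e. \<exists>f \<in> G e. \<exists>P \<in> associated_primes R (\<I> k). ideal_colon R (\<I> k) f = P"
    using prime_colon_is_associated[OF filtration_ideal] grade_carrier by blast
  then have "\<exists>f \<in> G (v_number R G (\<I> k)). \<exists>P \<in> associated_primes R (\<I> k). ideal_colon R (\<I> k) f = P"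
    unfolding v_number_def by (rule LeastI_ex)
  then show thesis using that by (auto simp: associated_primes_def)
qed

lemma initial_degree_le:
  assumes "x \<in> \<I> k" "x \<in> G e" "x \<noteq> \<zero>"
  shows "initial_degree R G (\<I> k) \<le> e"
  unfolding initial_degree_def by (rule Least_le) (use assms in auto)

lemma initial_degree_witness:
  assumes "1 \<le> k"
  obtains x where "x \<in> \<I> k" "x \<in> G (initial_degree R G (\<I> k))" "x \<noteq> \<zero>"
proof -
  have "\<I> k \<inter> G (initial_degree R G (\<I> k)) \<noteq> {\<zero>}"
    unfolding initial_degree_def
    using graded_ideal.exists_nonzero_homogeneous[OF filtration_graded nonzero[OF assms]]
    by (rule LeastI_ex)
  moreover have "\<zero> \<in> \<I> k \<inter> G (initial_degree R G (\<I> k))"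
    using grade_zero additive_subgroup.zero_closed[OF filtration_subgroup] by blast
  ultimately show thesis using that by blast
qed

text \<open>For \<open>x\<close> of least degree in \<open>\<I> 1\<close>, the prime
  \<open>(\<I> k : g)\<close> contains \<open>x [^] k\<close>, hence \<open>x\<close>. Then
  \<open>x \<otimes> g\<close> is a nonzero element of \<open>\<I> k\<close> of the degree on the
  right.\<close>

lemma initial_degree_le_v_number:
  assumes k: "1 \<le> k"
  shows "initial_degree R G (\<I> k) \<le> v_number R G (\<I> k) + initial_degree R G (\<I> 1)"
proof -
  obtain g where g: "g \<in> G (v_number R G (\<I> k))" "primeideal (ideal_colon R (\<I> k) g) R"
    using v_number_witness[OF k] .
  obtain x where x: "x \<in> \<I> 1" "x \<in> G (initial_degree R G (\<I> 1))" "x \<noteq> \<zero>"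
    using initial_degree_witness[of 1] by auto
  have c: "g \<in> carrier R" "x \<in> carrier R" using g x grade_carrier by auto
  have "x [^] k \<in> \<I> k" using filtration_nat_pow[OF x(1), of k] by simp
  then have "x [^] k \<in> ideal_colon R (\<I> k) g"
    using c ideal.I_r_closed[OF filtration_ideal] by (simp add: ideal_colon_def)
  then have "x \<in> ideal_colon R (\<I> k) g"
    using primeideal.nat_pow_in_prime[OF g(2) c(2)] by blast
  then have "x \<otimes> g \<in> \<I> k" by (simp add: ideal_colon_def)
  moreover have "g \<noteq> \<zero>"
  proof
    assume "g = \<zero>"
    then have "ideal_colon R (\<I> k) g = carrier R"
      using additive_subgroup.zero_closed[OF filtration_subgroup] by (auto simp: ideal_colon_def)
    then show False using primeideal.I_notcarr[OF g(2)] by simp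
  qed
  then have "x \<otimes> g \<noteq> \<zero>" using x(3) c by (simp add: integral_iff)
  ultimately show ?thesis
    using initial_degree_le grade_mult[OF x(2) g(1)] by (simp add: add.commute)
qed

section \<open>Passage to the limit\<close>

lemma asymptotic_slope:
  "\<exists>L :: real.
     (\<lambda>k. real (v_number R G (\<I> k)) / real k) \<longlonglongrightarrow> L \<and>
     (\<lambda>k. real (initial_degree R G (\<I> k)) / real k) \<longlonglongrightarrow> L"
proof -
  let ?v = "\<lambda>k. v_number R G (\<I> k)"
  let ?\<alpha> = "\<lambda>k. initial_degree R G (\<I> k)"
  obtain \<rho> :: real and f m d where m: "1 \<le> m" and f: "f \<in> \<I> m" "f \<in> G d"
    and d: "real d = \<rho> * real m"
    and not_in: "\<forall>j::nat. f [^] j \<notin> \<I> (Suc (j * m))"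
    and lower: "\<forall>k e h. h \<in> \<I> k \<longrightarrow> h \<in> G e \<longrightarrow> h \<noteq> \<zero> \<longrightarrow> \<rho> * real k \<le> real e"
    using exists_slope by blast
  have "\<rho> \<ge> 0" using d m by (metis of_nat_0_le_iff of_nat_0_less_iff less_le_trans zero_less_one zero_le_mult_iff not_le)
  have \<alpha>_lower: "\<rho> * k \<le> ?\<alpha> k" if k: "1 \<le> k" for k
    using initial_degree_witness[OF k] lower by blast
  have "\<forall>c. \<exists>e J. 1 \<le> c \<longrightarrow> (\<forall>j\<ge>J. \<exists>g \<in> G (j * d + e). primeideal (ideal_colon R (\<I> (j * m + c)) g) R)"
    using eventually_prime_colon[OF f] not_in by blast
  then obtain e J where eJ: "\<And>c j. 1 \<le> c \<Longrightarrow> J c \<le> j \<Longrightarrow>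
      \<exists>g \<in> G (j * d + e c). primeideal (ideal_colon R (\<I> (j * m + c)) g) R"
    by metis
  \<comment> \<open>Only offsets \<open>c\<close> in \<open>{1..m}\<close> occur, so the maxima are
    uniform constants.\<close>
  define E where "E = Max (e ` {1..m})"
  define K where "K = Max (J ` {1..m})"
  have v_upper: "real (?v k) \<le> \<rho> * k + E" if k: "m * Suc K \<le> k" for k
  proof -
    \<comment> \<open>Dividing \<open>k - 1\<close> instead of \<open>k\<close> makes
      \<open>c\<close> range over \<open>{1..m}\<close>, as \<open>eJ\<close> requires
      \<open>1 \<le> c\<close>.\<close>
    define j where "j = (k - 1) div m"
    define c where "c = (k - 1) mod m + 1"
    have "1 \<le> k" using k m by (cases k) auto
    then have kjc: "k = j * m + c" unfolding j_def c_def
      using div_mult_mod_eq[of "k - 1" m] by simp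
    have c: "c \<in> {1..m}" using m by (simp add: c_def Suc_leI)
    have "m * Suc K \<le> j * m + c" using k unfolding kjc .
    also have "\<dots> \<le> m * Suc j" using c by simp
    finally have "K \<le> j" using m nat_mult_le_cancel1[of m "Suc K" "Suc j"] by simp
    moreover have "J c \<le> K" "e c \<le> E" using c by (auto simp: K_def E_def)
    ultimately obtain g where "g \<in> G (j * d + e c)" "primeideal (ideal_colon R (\<I> k) g) R"
      using eJ[of c j] c unfolding kjc by auto
    then have "?v k \<le> j * d + e c" by (rule v_number_le)
    then have "real (?v k) \<le> real (j * d + e c)" by (rule of_nat_mono)
    also have "\<dots> = \<rho> * real (j * m) + real (e c)" using d by simp
    also have "\<dots> \<le> \<rho> * k + E"
      using \<open>e c \<le> E\<close> \<open>\<rho> \<ge> 0\<close> by (intro add_mono mult_left_mono) (auto simp: kjc)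
    finally show ?thesis .
  qed
  \<comment> \<open>A sequence that stays within a constant of \<open>\<rho> * k\<close> has slope
    \<open>\<rho>\<close>; this serves both sequences.\<close>
  have limit: "(\<lambda>k. real (a k) / real k) \<longlonglongrightarrow> \<rho>"
    if lb: "\<And>k. 1 \<le> k \<Longrightarrow> \<rho> * k \<le> real (a k) + B" and ub: "\<And>k. m * Suc K \<le> k \<Longrightarrow> real (a k) \<le> \<rho> * k + B"
    for a :: "nat \<Rightarrow> nat" and B :: real
  proof (rule tendsto_sandwich)
    have pos: "1 \<le> k" if "m * Suc K \<le> k" for k using that m by (cases k) auto
    show "\<forall>\<^sub>F k in sequentially. \<rho> - B / real k \<le> real (a k) / real k"
      using eventually_ge_at_top[of 1]
    proof eventually_elim
      case (elim k)
      have "(\<rho> * real k - B) / real k \<le> real (a k) / real k"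
        using lb[OF elim] by (intro divide_right_mono) auto
      then show ?case using elim by (simp add: diff_divide_distrib)
    qed
    show "\<forall>\<^sub>F k in sequentially. real (a k) / real k \<le> \<rho> + B / real k"
      using eventually_ge_at_top[of "m * Suc K"]
    proof eventually_elim
      case (elim k)
      have "real (a k) / real k \<le> (\<rho> * real k + B) / real k"
        using ub[OF elim] by (intro divide_right_mono) auto
      then show ?case using pos[OF elim] by (simp add: add_divide_distrib)
    qed
    show "(\<lambda>k. \<rho> - B / real k) \<longlonglongrightarrow> \<rho>" "(\<lambda>k. \<rho> + B / real k) \<longlonglongrightarrow> \<rho>"
      using tendsto_diff[OF tendsto_const lim_const_over_n[of B], of \<rho>]
        tendsto_add[OF tendsto_const lim_const_over_n[of B], of \<rho>] by auto
  qed
  have compare: "real (?\<alpha> k) \<le> real (?v k) + ?\<alpha> 1" if "1 \<le> k" for k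
    using initial_degree_le_v_number[OF that] by linarith
  \<comment> \<open>\<open>E\<close> is the error in \<open>v_upper\<close> and
    \<open>?\<alpha> 1\<close> the gap in \<open>compare\<close>; their sum suits both
    sequences.\<close>
  define B where "B = real E + real (?\<alpha> 1)"
  have "(\<lambda>k. real (?v k) / real k) \<longlonglongrightarrow> \<rho>"
  proof (rule limit[of ?v B])
    show "\<rho> * k \<le> real (?v k) + B" if "1 \<le> k" for k
      using \<alpha>_lower[OF that] compare[OF that] unfolding B_def by linarith
    show "real (?v k) \<le> \<rho> * k + B" if "m * Suc K \<le> k" for k
      using v_upper[OF that] unfolding B_def by linarith
  qed
  moreover have "(\<lambda>k. real (?\<alpha> k) / real k) \<longlonglongrightarrow> \<rho>"
  proof (rule limit[of ?\<alpha> B])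
    show "\<rho> * k \<le> real (?\<alpha> k) + B" if "1 \<le> k" for k
      using \<alpha>_lower[OF that] unfolding B_def by linarith
    show "real (?\<alpha> k) \<le> \<rho> * k + B" if k: "m * Suc K \<le> k" for k
    proof -
      have "1 \<le> k" using k m by (cases k) auto
      then show ?thesis using v_upper[OF k] compare[of k] unfolding B_def by linarith
    qed
  qed
  ultimately show ?thesis by blast
qed

end

theorem theorem3p5:
  fixes R :: "('a, 'm) ring_scheme" (structure)
    and G :: "nat \<Rightarrow> 'a set"
    and \<I> :: "nat \<Rightarrow> 'a set"
  assumes "noetherian_domain R"
    and "graded_ring R G"
    and "graded_filtration R G \<I>"
    and "noetherian_ring (rees_algebra R \<I>)"
    and "\<And>k. k \<ge> 1 \<Longrightarrow> \<I> k \<noteq> {\<zero>} \<and> \<I> k \<noteq> carrier R"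
  shows "\<exists>L :: real.
     (\<lambda>k. real (v_number R G (\<I> k)) / real k) \<longlonglongrightarrow> L \<and>
     (\<lambda>k. real (initial_degree R G (\<I> k)) / real k) \<longlonglongrightarrow> L"
proof -
  interpret noetherian_graded_filtration R G \<I>
    by (intro noetherian_graded_filtration.intro noetherian_graded_filtration_axioms.intro)
      (use assms in auto)
  show ?thesis by (rule asymptotic_slope)
qed

end
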